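(* Let $n\ge 1$ and let $0<\alpha<1$. Then for every measurable set $E\subset\mathbb{R}^n$, $$\big|\{x\in\mathbb{R}^n : M_1\cdots M_n\chi_E(x)>\alpha\}\big| \le \left(1+4\,\frac{(1-\alpha)^{1/n}}{1-(1-\alpha)^{1/n}}\right)^n |E|.$$ Accordingly, letting $C_{1\cdots n}(\alpha)$ denote the sharp Tauberian constant of $M_1\cdots M_n$ with respect to $\alpha$, one has $$C_{1\cdots n}(\alpha)-1 \sim_n \Big(\frac{1}{\alpha}-1\Big)^{1/n}\quad\text{as }\alpha\to 1^-,$$ that is, there exist constants $c_n, c_n'>0$ and a number $\alpha_n\in(0,1)$, depending only on $n$, such that $c_n\left(\frac1\alpha-1\right)^{1/n}\le C_{1\cdots n}(\alpha)-1\le c_n'\left(\frac1\alpha-1\right)^{1/n}$ for all $\alpha\in(\alpha_n,1)$.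
   Context: $|\cdot|$ denotes Lebesgue measure on $\mathbb{R}^n$ and $\chi_E$ the indicator function of $E$. For $j=1,\ldots,n$, the directional maximal operator $M_j$ acts on functions on $\mathbb{R}^n$ by $$M_jf(x_1,\ldots,x_n) = \sup_{s<x_j<t}\frac{1}{t-s}\int_s^t |f(x_1,\ldots,x_{j-1},u,x_{j+1},\ldots,x_n)|\,du,$$ the supremum being over all real $s<t$ with $s<x_j<t$. $M_1\cdots M_n$ denotes the composition of these operators ($M_n$ is applied first, $M_1$ last). The sharp Tauberian constant is $$C_{1\cdots n}(\alpha) = \sup_{E}\frac{1}{|E|}\big|\{x\in\mathbb{R}^n : M_1\cdots M_n\chi_E(x)>\alpha\}\big|,$$ the supremum being over all measurable $E\subset\mathbb{R}^n$ with $0<|E|<\infty$. *)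

theory Defs
  imports "HOL-Analysis.Analysis"
begin

text \<open>
  Points of \<open>\<real>\<^sup>n\<close> are the extensional functions \<open>x \<in> {1..n} \<rightarrow>\<^sub>E UNIV\<close>, with coordinates
  \<open>x 1, \<dots>, x n\<close>. The completion makes the measurable sets the Lebesgue (not only Borel)
  measurable ones.
\<close>
definition lebesgue_n :: "nat \<Rightarrow> (nat \<Rightarrow> real) measure" where
  "lebesgue_n n = completion (\<Pi>\<^sub>M j\<in>{1..n}. lborel)"

text \<open>
  Functions take values in \<open>[0, \<infinity>]\<close>, so that \<open>|f| = f\<close> and the supremum, which may be infinite,
  is again such a function; this is what allows the operators to be composed.
  If \<open>f\<close> is Lebesgue measurable, the slice \<open>\<lambda>u. f (x(j := u))\<close> is measurable on almost every
  line; on the remaining lines the integral is a lower integral, and the values there affect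
  neither the measure of superlevel sets nor, outside a null set, further maximal functions.
\<close>
definition dir_maximal ::
  "nat \<Rightarrow> ((nat \<Rightarrow> real) \<Rightarrow> ennreal) \<Rightarrow> (nat \<Rightarrow> real) \<Rightarrow> ennreal" where
  "dir_maximal j f x =
     (SUP (s, t) \<in> {(s, t). s < x j \<and> x j < t}.
        (\<integral>\<^sup>+u\<in>{s..t}. f (x(j := u)) \<partial>lebesgue) / ennreal (t - s))"

text \<open>\<open>M\<^sub>1 (M\<^sub>2 (\<dots> (M\<^sub>n f)))\<close>\<close>
definition iter_maximal ::
  "nat \<Rightarrow> ((nat \<Rightarrow> real) \<Rightarrow> ennreal) \<Rightarrow> (nat \<Rightarrow> real) \<Rightarrow> ennreal" where
  "iter_maximal n f = foldr dir_maximal [1..<Suc n] f"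

definition superlevel :: "nat \<Rightarrow> real \<Rightarrow> (nat \<Rightarrow> real) set \<Rightarrow> (nat \<Rightarrow> real) set" where
  "superlevel n \<alpha> E =
     {x \<in> space (lebesgue_n n). iter_maximal n (indicator E) x > ennreal \<alpha>}"

definition tauberian_const :: "nat \<Rightarrow> real \<Rightarrow> ennreal" where
  "tauberian_const n \<alpha> =
     (SUP E \<in> {E \<in> sets (lebesgue_n n).
                 0 < emeasure (lebesgue_n n) E \<and> emeasure (lebesgue_n n) E < \<infinity>}.
        emeasure (lebesgue_n n) (superlevel n \<alpha> E) / emeasure (lebesgue_n n) E)"

end

theory Submission
  imports Defs
begin

text \<open>
  The upper bound is a product of one-dimensional bounds. On the line, the set where the maximal
  function of \<open>\<chi>\<^sub>E\<close> exceeds \<open>b\<close> is a countable union of intervals \<open>J\<close> with \<open>|E \<inter> J| > b |J|\<close>. A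
  finite family of intervals has a subfamily with the same union that covers no point more than
  twice, and \<open>|J - E| \<le> ((1 - b) / b) |E \<inter> J|\<close>, so passing from \<open>E\<close> to this set adds measure at
  most \<open>2 ((1 - b) / b) |E|\<close> (\<open>emeasure_countable_Union_dense_intervals\<close>). Fubini carries the bound
  over to each \<open>M\<^sub>j\<close> in dimension \<open>n\<close> (\<open>emeasure_superlevel_dir_maximal\<close>).

  The operators are then peeled off from the inside. If \<open>E' = {M\<^sub>n \<chi>\<^sub>E > b}\<close>, then
  \<open>M\<^sub>n \<chi>\<^sub>E \<le> b + (1 - b) \<chi>\<^sub>E\<^sub>'\<close> because averages of \<open>\<chi>\<^sub>E\<close> are at most \<open>1\<close>, and the remaining operators
  are sublinear and do not increase constants. So a value of \<open>M\<^sub>1 \<cdots> M\<^sub>n \<chi>\<^sub>E\<close> above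
  \<open>1 - (1 - b)\<^sup>n\<close> forces a value of \<open>M\<^sub>1 \<cdots> M\<^sub>n\<^sub>-\<^sub>1 \<chi>\<^sub>E\<^sub>'\<close> above \<open>1 - (1 - b)\<^sup>n\<^sup>-\<^sup>1\<close>
  (\<open>emeasure_superlevel_foldr_dir_maximal\<close>). The choice \<open>1 - b = (1 - \<alpha>)\<^sup>1\<^sup>/\<^sup>n\<close> gives the theorem,
  even with the constant \<open>2\<close> in place of \<open>4\<close>.

  All this is done for Borel sets. A Lebesgue measurable \<open>E\<close> lies between Borel sets \<open>A \<subseteq> E \<subseteq> B\<close>
  that agree almost everywhere. By Fubini the maximal operators respect equality almost
  everywhere, so the superlevel set of \<open>E\<close> lies between two Borel sets that agree almost everywhere
  (\<open>superlevel_sandwich\<close>).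

  For the lower bound, remove from the open unit cube the thin diagonal slabs where the fractional
  part of \<open>x\<^sub>1 + \<cdots> + x\<^sub>n\<close> is at most \<open>e\<close>. Every line parallel to an axis that meets the cube then
  loses exactly the fraction \<open>e\<close> of its length in the cube, so the rest has measure \<open>1 - e\<close>. Each of the operators
  multiplies the defect on the slabs by \<open>e\<close> when it averages over the whole segment in the cube,
  while the value \<open>1\<close> off the slabs persists. Hence \<open>M\<^sub>1 \<cdots> M\<^sub>n\<close> is at least \<open>1 - e\<^sup>n\<close> on the
  whole cube (\<open>foldr_dir_maximal_slotted_cube_ge\<close>): a gain of measure of order \<open>e\<close> at a level
  \<open>\<alpha>\<close> with \<open>1 - \<alpha>\<close> of order \<open>e\<^sup>n\<close>.
\<close>

section \<open>Directional maximal functions: monotonicity, constants, measurability\<close>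

abbreviation lborel_prod :: "nat set \<Rightarrow> (nat \<Rightarrow> real) measure" where
  "lborel_prod I \<equiv> PiM I (\<lambda>_. lborel)"

interpretation lborel_prod: product_sigma_finite "\<lambda>_::nat. lborel :: real measure"
  by standard

lemma measurable_slice [measurable]:
  assumes "x \<in> space (lborel_prod I)" "j \<in> I"
  shows "(\<lambda>u. x(j := u)) \<in> lborel \<rightarrow>\<^sub>M lborel_prod I"
  by (rule measurable_fun_upd[where J = I]) (use assms in auto)

lemma borel_measurable_slice:
  assumes "f \<in> borel_measurable (lborel_prod I)" "x \<in> space (lborel_prod I)" "j \<in> I"
  shows "(\<lambda>u. f (x(j := u))) \<in> borel_measurable lborel"
  using measurable_compose[OF measurable_slice[OF assms(2,3)] assms(1)] .

lemma fun_upd_in_space: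
  assumes "x \<in> space (lborel_prod (I - {j})) \<or> x \<in> space (lborel_prod I)" "j \<in> I"
  shows "x(j := u) \<in> space (lborel_prod I)"
  using assms by (auto simp: space_PiM PiE_iff extensional_def)

lemma dir_maximal_altdef:
  "dir_maximal j f x =
     (SUP (s, t) \<in> {(s, t). s < x j \<and> x j < t}.
        (\<integral>\<^sup>+u\<in>{s..t}. f (x(j := u)) \<partial>lborel) / ennreal (t - s))"
  unfolding dir_maximal_def nn_integral_completion ..

lemma less_divide_ennreal_iff:
  assumes "0 < c"
  shows "a < b / ennreal c \<longleftrightarrow> a * ennreal c < b"
proof -
  have c: "0 < ennreal c" "ennreal c < top" using assms by auto
  have "b / ennreal c * ennreal c = b"
    using assms by (simp add: ennreal_divide_times divide_ennreal)
  then have "b / ennreal c \<le> a \<longleftrightarrow> b \<le> a * ennreal c"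
    using mult_right_mono[of "b / ennreal c" a "ennreal c"] divide_le_posI_ennreal[OF c(1), of b a]
    by (auto simp: mult.commute)
  then show ?thesis by (simp add: not_le[symmetric])
qed

lemma less_dir_maximal_iff:
  "a < dir_maximal j f x \<longleftrightarrow>
     (\<exists>s t. s < x j \<and> x j < t \<and> a * ennreal (t - s) < (\<integral>\<^sup>+u\<in>{s..t}. f (x(j := u)) \<partial>lborel))"
  unfolding dir_maximal_altdef less_SUP_iff
  by (fastforce simp: less_divide_ennreal_iff)

text \<open>
  Enlarging an interval with average above \<open>a\<close> slightly does not decrease the integral and increases
  the length by little, so rational endpoints suffice. This makes superlevel sets countable unions.
\<close>
lemma less_dir_maximal_iff_rat:
  "a < dir_maximal j f x \<longleftrightarrow>
     (\<exists>s\<in>\<rat>. \<exists>t\<in>\<rat>. s < x j \<and> x j < t \<and>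
        a * ennreal (t - s) < (\<integral>\<^sup>+u\<in>{s..t}. f (x(j := u)) \<partial>lborel))"
proof
  assume "a < dir_maximal j f x"
  then obtain s t where st: "s < x j" "x j < t"
    and less: "a * ennreal (t - s) < (\<integral>\<^sup>+u\<in>{s..t}. f (x(j := u)) \<partial>lborel)" (is "_ < ?J")
    unfolding less_dir_maximal_iff by blast
  have "a \<noteq> top"
    using less st by (auto simp: ennreal_top_mult)
  then obtain r where r: "a = ennreal r" "0 \<le> r"
    by (cases a) auto
  have "ennreal (r * (t - s)) < ?J"
    using less r st by (simp add: ennreal_mult')
  then obtain b where b: "ennreal (r * (t - s)) < b" "b < ?J"
    using dense by blast
  then obtain i where i: "b = ennreal i" "0 \<le> i"
    by (cases b) auto
  have ri: "r * (t - s) < i"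
    using b i r st by (simp add: ennreal_less_iff)
  \<comment> \<open>Widening the interval by \<open>d\<close> on both sides adds \<open>2 * d * r\<close> to \<open>r * (t - s)\<close>, and \<open>d\<close> keeps the sum below \<open>i\<close>.\<close>
  define d where "d = (i - r * (t - s)) / (2 * (r + 1))"
  have "0 < d" using ri r by (simp add: d_def)
  obtain s' where s': "s' \<in> \<rat>" "s - d < s'" "s' < s"
    using Rats_dense_in_real[of "s - d" s] \<open>0 < d\<close> by auto
  obtain t' where t': "t' \<in> \<rat>" "t < t'" "t' < t + d"
    using Rats_dense_in_real[of t "t + d"] \<open>0 < d\<close> by auto
  have "r * (t' - s') \<le> r * (t - s + 2 * d)"
    using s' t' r by (intro mult_left_mono) auto
  also have "\<dots> \<le> r * (t - s) + 2 * d * (r + 1)"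
    using \<open>0 < d\<close> by (simp add: algebra_simps)
  also have "2 * d * (r + 1) = i - r * (t - s)"
    using r by (simp add: d_def field_simps)
  finally have "r * (t' - s') \<le> i" by simp
  then have "a * ennreal (t' - s') \<le> b"
    using i r s' t' st by (simp add: ennreal_mult'[symmetric] ennreal_leI)
  also have "b < ?J" by fact
  also have "?J \<le> (\<integral>\<^sup>+u\<in>{s'..t'}. f (x(j := u)) \<partial>lborel)"
    using s' t' by (intro nn_integral_mono) (auto simp: indicator_def)
  finally show "\<exists>s\<in>\<rat>. \<exists>t\<in>\<rat>. s < x j \<and> x j < t \<and>
        a * ennreal (t - s) < (\<integral>\<^sup>+u\<in>{s..t}. f (x(j := u)) \<partial>lborel)"
    using s' t' st by (intro bexI[of _ s'] bexI[of _ t']) auto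
qed (auto simp: less_dir_maximal_iff)

lemma dir_maximal_mono:
  assumes "\<And>u. f (x(j := u)) \<le> g (x(j := u))"
  shows "dir_maximal j f x \<le> dir_maximal j g x"
  unfolding dir_maximal_altdef
  by (rule SUP_subset_mono)
    (auto intro!: divide_right_mono_ennreal nn_integral_mono mult_right_mono assms)

lemma borel_measurable_dir_maximal [measurable]:
  assumes [measurable]: "f \<in> borel_measurable (lborel_prod I)" and j: "j \<in> I"
  shows "dir_maximal j f \<in> borel_measurable (lborel_prod I)"
proof (rule borel_measurableI_greater)
  fix a :: ennreal
  have [measurable]: "(\<lambda>(x, u). f (x(j := u))) \<in> borel_measurable (lborel_prod I \<Otimes>\<^sub>M lborel)"
  proof -
    have "(\<lambda>p. (fst p)(j := snd p)) \<in> lborel_prod I \<Otimes>\<^sub>M lborel \<rightarrow>\<^sub>M lborel_prod I"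
      by (rule measurable_fun_upd[where J = I]) (use j in auto)
    then show ?thesis by (simp add: split_beta' )
  qed
  have [measurable]: "(\<lambda>x. x j) \<in> borel_measurable (lborel_prod I)"
    using measurable_component_singleton[OF j, of "\<lambda>_. lborel"] by simp
  have [measurable]: "countable \<rat>" by (rule countable_rat)
  show "{x \<in> space (lborel_prod I). a < dir_maximal j f x} \<in> sets (lborel_prod I)"
    unfolding less_dir_maximal_iff_rat by measurable
qed

text \<open>
  Only points of the product space matter, since updating one coordinate does not leave that space.
\<close>
lemma foldr_dir_maximal_mono:
  assumes "\<And>y. y \<in> space (lborel_prod I) \<Longrightarrow> f y \<le> g y"
    and "set js \<subseteq> I" "x \<in> space (lborel_prod I)"
  shows "foldr dir_maximal js f x \<le> foldr dir_maximal js g x"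
  using assms(2,3)
proof (induction js arbitrary: x)
  case (Cons j js)
  then have "x(j := u) \<in> space (lborel_prod I)" for u
    by (intro fun_upd_in_space) auto
  with Cons show ?case
    by (auto intro!: dir_maximal_mono)
qed (use assms in simp)

lemma borel_measurable_foldr_dir_maximal [measurable]:
  assumes "f \<in> borel_measurable (lborel_prod I)" "set js \<subseteq> I"
  shows "foldr dir_maximal js f \<in> borel_measurable (lborel_prod I)"
  using assms(2) by (induction js) (auto intro: assms(1))

lemma le_dir_maximal:
  assumes "s < x j" "x j < t" "a * ennreal (t - s) \<le> (\<integral>\<^sup>+u\<in>{s..t}. f (x(j := u)) \<partial>lborel)"
  shows "a \<le> dir_maximal j f x"
proof -
  have "a = a * ennreal (t - s) / ennreal (t - s)"
    using assms by (subst mult_divide_eq_ennreal) auto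
  also have "\<dots> \<le> (\<integral>\<^sup>+u\<in>{s..t}. f (x(j := u)) \<partial>lborel) / ennreal (t - s)"
    by (intro divide_right_mono_ennreal assms)
  also have "\<dots> \<le> dir_maximal j f x"
    unfolding dir_maximal_altdef by (rule SUP_upper2[of "(s, t)"]) (use assms in auto)
  finally show ?thesis .
qed

lemma nn_integral_slice_le_dir_maximal:
  assumes "s < x j" "x j < t"
  shows "(\<integral>\<^sup>+u\<in>{s..t}. f (x(j := u)) \<partial>lborel) \<le> dir_maximal j f x * ennreal (t - s)"
  using assms by (metis less_dir_maximal_iff less_irrefl not_le)

lemma dir_maximal_le_const:
  assumes "\<And>u. f (x(j := u)) \<le> c"
  shows "dir_maximal j f x \<le> c"
proof (rule ccontr)
  assume "\<not> dir_maximal j f x \<le> c"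
  then obtain s t where st: "s < x j" "x j < t"
    and less: "c * ennreal (t - s) < (\<integral>\<^sup>+u\<in>{s..t}. f (x(j := u)) \<partial>lborel)"
    unfolding not_le less_dir_maximal_iff by blast
  have "(\<integral>\<^sup>+u\<in>{s..t}. f (x(j := u)) \<partial>lborel) \<le> (\<integral>\<^sup>+u\<in>{s..t}. c \<partial>lborel)"
    by (intro nn_integral_mono mult_right_mono assms) auto
  also have "\<dots> = c * ennreal (t - s)"
    using st by (simp add: nn_integral_cmult_indicator)
  finally show False using less by simp
qed

text \<open>
  Sublinearity in the form needed for peeling off operators: an average of \<open>a + c f\<close> is \<open>a\<close> plus
  \<open>c\<close> times an average of \<open>f\<close>.
\<close>
lemma dir_maximal_affine_le:
  assumes f: "f \<in> borel_measurable (lborel_prod I)" and "x \<in> space (lborel_prod I)" "j \<in> I"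
  shows "dir_maximal j (\<lambda>y. a + c * f y) x \<le> a + c * dir_maximal j f x"
proof (rule ccontr)
  assume "\<not> ?thesis"
  then obtain s t where st: "s < x j" "x j < t"
    and less: "(a + c * dir_maximal j f x) * ennreal (t - s)
                 < (\<integral>\<^sup>+u\<in>{s..t}. (a + c * f (x(j := u))) \<partial>lborel)"
    unfolding not_le less_dir_maximal_iff by blast
  note [measurable] = borel_measurable_slice[OF assms]
  have "(\<integral>\<^sup>+u\<in>{s..t}. (a + c * f (x(j := u))) \<partial>lborel)
      = (\<integral>\<^sup>+u. a * indicator {s..t} u + c * (f (x(j := u)) * indicator {s..t} u) \<partial>lborel)"
    by (simp add: algebra_simps)
  also have "\<dots> = a * ennreal (t - s) + c * (\<integral>\<^sup>+u\<in>{s..t}. f (x(j := u)) \<partial>lborel)"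
    using st by (simp add: nn_integral_add nn_integral_cmult nn_integral_cmult_indicator)
  also have "\<dots> \<le> a * ennreal (t - s) + c * (dir_maximal j f x * ennreal (t - s))"
    using st by (intro add_left_mono mult_left_mono nn_integral_slice_le_dir_maximal) auto
  also have "\<dots> = (a + c * dir_maximal j f x) * ennreal (t - s)"
    by (simp add: algebra_simps)
  finally show False using less by simp
qed

lemma foldr_dir_maximal_affine_le:
  assumes f: "f \<in> borel_measurable (lborel_prod I)"
    and "set js \<subseteq> I" "x \<in> space (lborel_prod I)"
  shows "foldr dir_maximal js (\<lambda>y. a + c * f y) x \<le> a + c * foldr dir_maximal js f x"
  using assms(2,3)
proof (induction js arbitrary: x)
  case (Cons j js)
  have "foldr dir_maximal (j # js) (\<lambda>y. a + c * f y) x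
      \<le> dir_maximal j (\<lambda>y. a + c * foldr dir_maximal js f y) x"
    unfolding foldr.simps o_apply
    using Cons by (intro dir_maximal_mono Cons.IH fun_upd_in_space) auto
  also have "\<dots> \<le> a + c * foldr dir_maximal (j # js) f x"
    unfolding foldr.simps o_apply
    using Cons.prems f by (intro dir_maximal_affine_le[where I = I]) auto
  finally show ?case .
qed simp

section \<open>Slices of product measure and null sets\<close>

lemma nn_integral_lborel_prod_slice:
  assumes "finite I" "j \<in> I" "f \<in> borel_measurable (lborel_prod I)"
  shows "integral\<^sup>N (lborel_prod I) f =
           (\<integral>\<^sup>+x. (\<integral>\<^sup>+u. f (x(j := u)) \<partial>lborel) \<partial>lborel_prod (I - {j}))"
  using lborel_prod.product_nn_integral_insert[of "I - {j}" j f] assms by (simp add: insert_absorb)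

lemma borel_measurable_nn_integral_slice:
  assumes "j \<in> I" and f: "f \<in> borel_measurable (lborel_prod I)"
  shows "(\<lambda>x. \<integral>\<^sup>+u. f (x(j := u)) \<partial>lborel) \<in> borel_measurable (lborel_prod (I - {j}))"
proof -
  have "insert j (I - {j}) = I" using assms by auto
  then have "(\<lambda>(x, u). x(j := u)) \<in> lborel_prod (I - {j}) \<Otimes>\<^sub>M lborel \<rightarrow>\<^sub>M lborel_prod I"
    using measurable_add_dim[of j "I - {j}" "\<lambda>_. lborel"] by simp
  from measurable_compose[OF this f] show ?thesis
    by (intro lborel.borel_measurable_nn_integral) (simp add: split_beta')
qed

lemma sets_slice:
  assumes "x \<in> space (lborel_prod (I - {j}))" "j \<in> I" "A \<in> sets (lborel_prod I)"
  shows "{u. x(j := u) \<in> A} \<in> sets lborel"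
proof -
  have "(\<lambda>u. x(j := u)) \<in> lborel \<rightarrow>\<^sub>M lborel_prod I"
    by (rule measurable_fun_upd[where J = "I - {j}"]) (use assms in auto)
  from measurable_sets[OF this assms(3)] show ?thesis
    by (simp add: vimage_def)
qed

lemma nn_integral_indicator_slice:
  assumes "x \<in> space (lborel_prod (I - {j}))" "j \<in> I" "A \<in> sets (lborel_prod I)"
  shows "(\<integral>\<^sup>+u. indicator A (x(j := u)) \<partial>lborel) = emeasure lborel {u. x(j := u) \<in> A}"
proof -
  have "(\<integral>\<^sup>+u. indicator A (x(j := u)) \<partial>lborel) = (\<integral>\<^sup>+u. indicator {u. x(j := u) \<in> A} u \<partial>lborel)"
    by (intro nn_integral_cong) (simp add: indicator_def)
  also have "\<dots> = emeasure lborel {u. x(j := u) \<in> A}"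
    using sets_slice[OF assms] by (rule nn_integral_indicator)
  finally show ?thesis .
qed

lemma emeasure_lborel_prod_slice:
  assumes "finite I" "j \<in> I" "A \<in> sets (lborel_prod I)"
  shows "emeasure (lborel_prod I) A =
           (\<integral>\<^sup>+x. emeasure lborel {u. x(j := u) \<in> A} \<partial>lborel_prod (I - {j}))"
proof -
  have "emeasure (lborel_prod I) A = (\<integral>\<^sup>+x. indicator A x \<partial>lborel_prod I)"
    using assms by simp
  also have "\<dots> = (\<integral>\<^sup>+x. (\<integral>\<^sup>+u. indicator A (x(j := u)) \<partial>lborel) \<partial>lborel_prod (I - {j}))"
    using assms by (intro nn_integral_lborel_prod_slice) auto
  also have "\<dots> = (\<integral>\<^sup>+x. emeasure lborel {u. x(j := u) \<in> A} \<partial>lborel_prod (I - {j}))"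
    using assms by (intro nn_integral_cong nn_integral_indicator_slice)
  finally show ?thesis .
qed

text \<open>
  By Fubini, \<open>f\<close> and \<open>g\<close> agree almost everywhere on almost every line in direction \<open>j\<close>. On such a
  line all averages coincide, so the maximal functions agree at every point of the line.
\<close>
lemma dir_maximal_cong_AE:
  assumes "finite I" "j \<in> I"
    and [measurable]: "f \<in> borel_measurable (lborel_prod I)" "g \<in> borel_measurable (lborel_prod I)"
    and ae: "AE x in lborel_prod I. f x = g x"
  shows "AE x in lborel_prod I. dir_maximal j f x = dir_maximal j g x"
proof -
  define N where "N = {x \<in> space (lborel_prod I). f x \<noteq> g x}"
  have [measurable]: "N \<in> sets (lborel_prod I)"
    unfolding N_def by (rule borel_measurable_neq) fact+
  have "(\<integral>\<^sup>+x. (\<integral>\<^sup>+u. indicator N (x(j := u)) \<partial>lborel) \<partial>lborel_prod (I - {j}))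
      = (\<integral>\<^sup>+x. indicator N x \<partial>lborel_prod I)"
    using assms by (intro nn_integral_lborel_prod_slice[symmetric]) auto
  also have "\<dots> = (\<integral>\<^sup>+x. 0 \<partial>lborel_prod I)"
    using ae by (intro nn_integral_cong_AE) (auto simp: N_def indicator_def)
  also have "\<dots> = 0" by simp
  finally have "AE x in lborel_prod (I - {j}). (\<integral>\<^sup>+u. indicator N (x(j := u)) \<partial>lborel) = 0"
    using borel_measurable_nn_integral_slice[OF \<open>j \<in> I\<close>, of "indicator N"]
    by (subst (asm) nn_integral_0_iff_AE) auto
  then have eq: "AE x in lborel_prod (I - {j}). \<forall>v. dir_maximal j f (x(j := v)) = dir_maximal j g (x(j := v))"
    using AE_space
  proof eventually_elim
    case (elim x)
    have sp: "x(j := u) \<in> space (lborel_prod I)" for u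
        using elim(2) \<open>j \<in> I\<close> by (intro fun_upd_in_space) auto
    have "AE u in lborel. (indicator N (x(j := u)) :: ennreal) = 0"
      using elim(1) borel_measurable_slice[OF _ sp[of 0] \<open>j \<in> I\<close>, of "indicator N"]
      by (subst (asm) nn_integral_0_iff_AE) auto
    then have fg: "AE u in lborel. f (x(j := u)) = g (x(j := u))"
      by eventually_elim (use sp in \<open>auto simp: N_def indicator_def split: if_splits\<close>)
    have "(\<integral>\<^sup>+u\<in>{s..t}. f (x(j := u)) \<partial>lborel) = (\<integral>\<^sup>+u\<in>{s..t}. g (x(j := u)) \<partial>lborel)" for s t
      using fg by (intro nn_integral_cong_AE) auto
    then show ?case by (simp add: dir_maximal_altdef)
  qed
  \<comment> \<open>Almost every line carries no exceptional point at all, so the exceptional set is null by Fubini.\<close>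
  define N' where "N' = {x \<in> space (lborel_prod I). dir_maximal j f x \<noteq> dir_maximal j g x}"
  have [measurable]: "N' \<in> sets (lborel_prod I)"
    unfolding N'_def
    by (intro borel_measurable_neq borel_measurable_dir_maximal) fact+
  have "emeasure (lborel_prod I) N' = (\<integral>\<^sup>+x. emeasure lborel {u. x(j := u) \<in> N'} \<partial>lborel_prod (I - {j}))"
    using assms by (intro emeasure_lborel_prod_slice) auto
  also have "\<dots> = (\<integral>\<^sup>+x. 0 \<partial>lborel_prod (I - {j}))"
    using eq by (intro nn_integral_cong_AE) (auto simp: N'_def)
  finally have "emeasure (lborel_prod I) N' = 0" by simp
  then show ?thesis
    unfolding N'_def by (subst AE_iff_measurable[OF _ refl]) (use \<open>N' \<in> _\<close> in \<open>auto simp: N'_def\<close>)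
qed

lemma foldr_dir_maximal_cong_AE:
  assumes "finite I" "set js \<subseteq> I"
    and "f \<in> borel_measurable (lborel_prod I)" "g \<in> borel_measurable (lborel_prod I)"
    and "AE x in lborel_prod I. f x = g x"
  shows "AE x in lborel_prod I. foldr dir_maximal js f x = foldr dir_maximal js g x"
  using assms(2)
proof (induction js)
  case (Cons j js)
  then have "AE x in lborel_prod I. foldr dir_maximal js f x = foldr dir_maximal js g x"
    by simp
  with Cons.prems show ?case
    unfolding foldr.simps o_apply
    by (intro dir_maximal_cong_AE borel_measurable_foldr_dir_maximal assms) auto
qed (use assms in simp)

section \<open>Unions of intervals of high density on the line\<close>

text \<open>
  Take a subfamily of least cardinality with the same union. Among the intervals that contain a
  point \<open>x\<close>, the one reaching furthest to the left and the one reaching furthest to the right cover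
  all the others, so minimality leaves no third one. A pair stands for the open interval between its
  components.
\<close>
lemma minimal_subcover_overlap:
  fixes F :: "(real \<times> real) set"
  assumes "finite F"
  obtains G where "G \<subseteq> F" "(\<Union>p\<in>G. {fst p<..<snd p}) = (\<Union>p\<in>F. {fst p<..<snd p})"
    "\<And>x. card {p \<in> G. x \<in> {fst p<..<snd p}} \<le> 2"
proof -
  let ?U = "\<lambda>G. \<Union>p\<in>G. {fst p<..<snd p :: real}"
  let ?P = "\<lambda>G. G \<subseteq> F \<and> ?U G = ?U F"
  obtain G where G: "?P G" and min: "\<And>H. ?P H \<Longrightarrow> card G \<le> card H"
    using ex_has_least_nat[of ?P F card] by auto
  have "finite G" using G assms finite_subset by blast
  have "card {p \<in> G. x \<in> {fst p<..<snd p}} \<le> 2" for x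
  proof -
    define H where "H = {p \<in> G. x \<in> {fst p<..<snd p}}"
    have "finite H" using \<open>finite G\<close> by (simp add: H_def)
    show ?thesis
    proof (cases "H = {}")
      case False
      obtain p where p: "p \<in> H" "\<And>r. r \<in> H \<Longrightarrow> fst p \<le> fst r"
        using ex_min_if_finite[of "fst ` H"] \<open>finite H\<close> False by force
      obtain q where q: "q \<in> H" "\<And>r. r \<in> H \<Longrightarrow> snd r \<le> snd q"
      proof -
        have "Max (snd ` H) \<in> snd ` H" using \<open>finite H\<close> False by (intro Max_in) auto
        then obtain q where "q \<in> H" "snd q = Max (snd ` H)" by force
        then show thesis using that \<open>finite H\<close> by (metis Max_ge finite_imageI imageI)
      qed
      have "H \<subseteq> {p, q}"
      proof (rule ccontr)
        assume "\<not> H \<subseteq> {p, q}"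
        then obtain r where r: "r \<in> H" "r \<noteq> p" "r \<noteq> q" by auto
        have "{fst r<..<snd r} \<subseteq> {fst p<..<snd p} \<union> {fst q<..<snd q}"
        proof
          fix y assume "y \<in> {fst r<..<snd r}"
          then show "y \<in> {fst p<..<snd p} \<union> {fst q<..<snd q}"
            using p(2)[OF r(1)] q(2)[OF r(1)] p(1) q(1) by (cases "y \<le> x") (auto simp: H_def)
        qed
        also have "\<dots> \<subseteq> ?U (G - {r})"
          using r p(1) q(1) by (intro Un_least UN_upper) (auto simp: H_def)
        finally have "?U (insert r (G - {r})) = ?U (G - {r})"
          by (subst UN_insert) (rule Un_absorb1)
        moreover have "insert r (G - {r}) = G"
          using r(1) by (auto simp: H_def)
        ultimately have "?U (G - {r}) = ?U G"
          by metis
        then have "card G \<le> card (G - {r})"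
          using G by (intro min) auto
        then show False
          using card_Diff1_less[OF \<open>finite G\<close>, of r] r by (auto simp: H_def)
      qed
      then have "card H \<le> card {p, q}" by (intro card_mono) auto
      also have "\<dots> \<le> 2" by (simp add: card_insert_if)
      finally show ?thesis by (simp add: H_def)
    next
      case True
      then have "card H = 0" by simp
      then show ?thesis unfolding H_def by linarith
    qed
  qed
  with that G show thesis by blast
qed

text \<open>
  Each interval \<open>J\<close> satisfies \<open>|J - E| \<le> ((1 - b) / b) |E \<inter> J|\<close>, and in a subfamily of overlap at most
  two the sets \<open>E \<inter> J\<close> have total measure at most \<open>2 |E|\<close>.
\<close>
lemma emeasure_finite_Union_dense_intervals:
  fixes F :: "(real \<times> real) set"
  assumes "finite F" and E: "E \<in> sets lborel" and b: "0 < b" "b < 1"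
    and ord: "\<And>p. p \<in> F \<Longrightarrow> fst p < snd p"
    and dense: "\<And>p. p \<in> F \<Longrightarrow> ennreal (b * (snd p - fst p)) \<le> emeasure lborel (E \<inter> {fst p<..<snd p})"
  shows "emeasure lborel (\<Union>p\<in>F. {fst p<..<snd p})
           \<le> ennreal (1 + 2 * ((1 - b) / b)) * emeasure lborel E"
proof -
  have [measurable]: "E \<in> sets borel" using E by simp
  obtain G where G: "G \<subseteq> F" "(\<Union>p\<in>G. {fst p<..<snd p}) = (\<Union>p\<in>F. {fst p<..<snd p})"
    and overlap: "\<And>x. card {p \<in> G. x \<in> {fst p<..<snd p}} \<le> 2"
    by (rule minimal_subcover_overlap[OF \<open>finite F\<close>]) (rule that)
  have "finite G" using G \<open>finite F\<close> finite_subset by blast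
  let ?I = "\<lambda>p :: real \<times> real. {fst p<..<snd p}"
  let ?r = "ennreal ((1 - b) / b)"
  have gap: "emeasure lborel (?I p - E) \<le> ?r * emeasure lborel (E \<inter> ?I p)" if "p \<in> G" for p
  proof -
    let ?l = "snd p - fst p"
    have l: "0 < ?l" using ord that G by auto
    have le: "emeasure lborel (E \<inter> ?I p) \<le> emeasure lborel (?I p)"
      by (intro emeasure_mono) auto
    have I: "emeasure lborel (?I p) = ennreal ?l"
      using l by simp
    obtain m where m: "emeasure lborel (E \<inter> ?I p) = ennreal m" "0 \<le> m"
      using le I by (cases "emeasure lborel (E \<inter> ?I p)") (auto simp: top_unique)
    have ml: "b * ?l \<le> m"
      using dense[of p] that G m by (auto simp: ennreal_le_iff)
    have "emeasure lborel (?I p - E) = emeasure lborel (?I p - (E \<inter> ?I p))"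
      by (intro arg_cong[where f = "emeasure lborel"]) auto
    also have "\<dots> = emeasure lborel (?I p) - emeasure lborel (E \<inter> ?I p)"
      using m by (intro emeasure_Diff) auto
    also have "\<dots> = ennreal (?l - m)"
      using m I by (simp add: ennreal_minus)
    also have "\<dots> \<le> ennreal ((1 - b) / b * m)"
      using ml b by (intro ennreal_leI) (simp add: field_simps)
    also have "\<dots> = ?r * ennreal m"
      using m b by (intro ennreal_mult) auto
    finally show ?thesis unfolding m(1) .
  qed
  have "(\<Sum>p\<in>G. emeasure lborel (E \<inter> ?I p)) = (\<Sum>p\<in>G. \<integral>\<^sup>+x. indicator E x * indicator (?I p) x \<partial>lborel)"
    by (simp flip: indicator_inter_arith)
  also have "\<dots> = (\<integral>\<^sup>+x. (\<Sum>p\<in>G. indicator E x * indicator (?I p) x) \<partial>lborel)"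
    by (intro nn_integral_sum[symmetric]) auto
  also have "\<dots> \<le> (\<integral>\<^sup>+x. 2 * indicator E x \<partial>lborel)"
  proof (rule nn_integral_mono)
    fix x
    have "(\<Sum>p\<in>G. indicator (?I p) x :: ennreal) = of_nat (card {p \<in> G. x \<in> ?I p})"
      using \<open>finite G\<close> by (simp add: indicator_def sum.If_cases Int_def)
    also have "\<dots> \<le> of_nat 2" using overlap[of x] by (subst of_nat_le_iff) auto
    finally show "(\<Sum>p\<in>G. indicator E x * indicator (?I p) x :: ennreal) \<le> 2 * indicator E x"
        by (cases "x \<in> E") auto
  qed
  also have "\<dots> = 2 * emeasure lborel E" by (simp add: nn_integral_cmult)
  finally have sum: "(\<Sum>p\<in>G. emeasure lborel (E \<inter> ?I p)) \<le> 2 * emeasure lborel E" .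
  have [measurable]: "(\<Union>p\<in>G. ?I p - E) \<in> sets lborel"
    using \<open>finite G\<close> by (intro sets.finite_UN) auto
  have "emeasure lborel (\<Union>p\<in>F. ?I p) \<le> emeasure lborel (E \<union> (\<Union>p\<in>G. ?I p - E))"
    unfolding G(2)[symmetric] 
    by (intro emeasure_mono sets.Un E) (blast, fact)
  also have "\<dots> \<le> emeasure lborel E + emeasure lborel (\<Union>p\<in>G. ?I p - E)"
    by (intro emeasure_subadditive E) fact
  also have "\<dots> \<le> emeasure lborel E + (\<Sum>p\<in>G. emeasure lborel (?I p - E))"
    using \<open>finite G\<close> by (intro add_left_mono emeasure_subadditive_finite) auto
  also have "\<dots> \<le> emeasure lborel E + (\<Sum>p\<in>G. ?r * emeasure lborel (E \<inter> ?I p))"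
    by (intro add_left_mono sum_mono gap)
  also have "\<dots> \<le> emeasure lborel E + ?r * (2 * emeasure lborel E)"
    unfolding sum_distrib_left[symmetric] by (intro add_left_mono mult_left_mono sum) auto
  also have "\<dots> = ennreal (1 + 2 * ((1 - b) / b)) * emeasure lborel E"
  proof -
    have "ennreal (1 + 2 * r) = 1 + 2 * ennreal r" if "0 \<le> r" for r
      using that by (simp add: ennreal_mult)
    from this[of "(1 - b) / b"] b have "ennreal (1 + 2 * ((1 - b) / b)) = 1 + 2 * ?r"
      by simp
    then show ?thesis by (simp add: algebra_simps)
  qed
  finally show ?thesis .
qed

lemma emeasure_countable_Union_dense_intervals:
  fixes F :: "(real \<times> real) set"
  assumes "countable F" and E: "E \<in> sets lborel" and b: "0 < b" "b < 1"
    and ord: "\<And>p. p \<in> F \<Longrightarrow> fst p < snd p"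
    and dense: "\<And>p. p \<in> F \<Longrightarrow> ennreal (b * (snd p - fst p)) \<le> emeasure lborel (E \<inter> {fst p<..<snd p})"
  shows "emeasure lborel (\<Union>p\<in>F. {fst p<..<snd p})
           \<le> ennreal (1 + 2 * ((1 - b) / b)) * emeasure lborel E"
proof (cases "F = {}")
  case False
  let ?A = "\<lambda>n. \<Union>p\<in>from_nat_into F ` {..n}. {fst p<..<snd p}"
  have "F = range (from_nat_into F)"
    using False \<open>countable F\<close> by simp
  then have "(\<Union>p\<in>F. {fst p<..<snd p}) = \<Union> ((\<lambda>p. {fst p<..<snd p}) ` range (from_nat_into F))"
    by (rule arg_cong)
  also have "\<dots> = (\<Union>n. ?A n)"
    by auto
  also have "emeasure lborel \<dots> = (SUP n. emeasure lborel (?A n))"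
  proof (rule SUP_emeasure_incseq[symmetric])
    show "incseq ?A" by (auto simp: incseq_def intro: order.trans)
  qed auto
  also have "\<dots> \<le> ennreal (1 + 2 * ((1 - b) / b)) * emeasure lborel E"
    using from_nat_into[OF False]
    by (intro SUP_least emeasure_finite_Union_dense_intervals E b) (auto intro: ord dense)
  finally show ?thesis .
qed simp

section \<open>Superlevel sets of iterated maximal functions of Borel sets\<close>

text \<open>
  On a line the superlevel set is the union of the intervals with rational endpoints on which the
  slice of \<open>E\<close> has density above \<open>b\<close>.
\<close>
lemma emeasure_superlevel_slice:
  assumes x: "x \<in> space (lborel_prod (I - {j}))" and j: "j \<in> I" and E: "E \<in> sets (lborel_prod I)"
    and b: "0 < b" "b < 1"
  shows "emeasure lborel {u. ennreal b < dir_maximal j (indicator E) (x(j := u))}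
           \<le> ennreal (1 + 2 * ((1 - b) / b)) * emeasure lborel {u. x(j := u) \<in> E}"
proof -
  define S where "S = {u. x(j := u) \<in> E}"
  have S: "S \<in> sets lborel" unfolding S_def by (rule sets_slice[OF x j E])
  have int: "(\<integral>\<^sup>+u\<in>{s..t}. indicator E (x(j := u)) \<partial>lborel) = emeasure lborel (S \<inter> {s<..<t})" for s t
  proof -
    have "(\<integral>\<^sup>+u\<in>{s..t}. indicator E (x(j := u)) \<partial>lborel) = (\<integral>\<^sup>+u. indicator (S \<inter> {s<..<t}) u \<partial>lborel)"
      using AE_lborel_singleton[of s] AE_lborel_singleton[of t]
      by (intro nn_integral_cong_AE, eventually_elim) (auto simp: S_def indicator_def)
    also have "\<dots> = emeasure lborel (S \<inter> {s<..<t})"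
      using S by (intro nn_integral_indicator) auto
    finally show ?thesis .
  qed
  define F where "F = {(s, t) \<in> \<rat> \<times> \<rat>. s < t \<and>
    ennreal b * ennreal (t - s) < emeasure lborel (S \<inter> {s<..<t})}"
  have "{u. ennreal b < dir_maximal j (indicator E) (x(j := u))} = (\<Union>p\<in>F. {fst p<..<snd p})"
    unfolding less_dir_maximal_iff_rat fun_upd_upd fun_upd_same int
    by (force simp: F_def)
  moreover have "countable F"
    by (rule countable_subset[of _ "\<rat> \<times> \<rat>"]) (auto simp: F_def intro: countable_SIGMA countable_rat)
  ultimately show ?thesis
    unfolding S_def[symmetric]
    using b by (simp only:, intro emeasure_countable_Union_dense_intervals S)
      (auto simp: F_def ennreal_mult')
qed

lemma emeasure_superlevel_dir_maximal:
  assumes I: "finite I" and j: "j \<in> I" and E: "E \<in> sets (lborel_prod I)" and b: "0 < b" "b < 1"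
  shows "emeasure (lborel_prod I) {x \<in> space (lborel_prod I). ennreal b < dir_maximal j (indicator E) x}
           \<le> ennreal (1 + 2 * ((1 - b) / b)) * emeasure (lborel_prod I) E"
proof -
  let ?P = "lborel_prod I" and ?P' = "lborel_prod (I - {j})"
  let ?L = "{x \<in> space ?P. ennreal b < dir_maximal j (indicator E) x}"
  have [measurable]: "dir_maximal j (indicator E) \<in> borel_measurable ?P"
    using E j by (intro borel_measurable_dir_maximal) auto
  have L: "?L \<in> sets ?P" by measurable
  have "emeasure ?P ?L = (\<integral>\<^sup>+x. emeasure lborel {u. x(j := u) \<in> ?L} \<partial>?P')"
    by (rule emeasure_lborel_prod_slice[OF I j L])
  also have "\<dots> \<le> (\<integral>\<^sup>+x. ennreal (1 + 2 * ((1 - b) / b)) * (\<integral>\<^sup>+u. indicator E (x(j := u)) \<partial>lborel) \<partial>?P')"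
  proof (rule nn_integral_mono)
    fix x assume x: "x \<in> space ?P'"
    have "{u. x(j := u) \<in> ?L} = {u. ennreal b < dir_maximal j (indicator E) (x(j := u))}"
      using fun_upd_in_space[of x I j] x j by auto
    then show "emeasure lborel {u. x(j := u) \<in> ?L}
        \<le> ennreal (1 + 2 * ((1 - b) / b)) * (\<integral>\<^sup>+u. indicator E (x(j := u)) \<partial>lborel)"
      using emeasure_superlevel_slice[OF x j E b] nn_integral_indicator_slice[OF x j E] by simp
  qed
  also have "\<dots> = ennreal (1 + 2 * ((1 - b) / b)) * (\<integral>\<^sup>+x. (\<integral>\<^sup>+u. indicator E (x(j := u)) \<partial>lborel) \<partial>?P')"
    using E j by (intro nn_integral_cmult borel_measurable_nn_integral_slice) auto
  also have "(\<integral>\<^sup>+x. (\<integral>\<^sup>+u. indicator E (x(j := u)) \<partial>lborel) \<partial>?P') = (\<integral>\<^sup>+x. indicator E x \<partial>?P)"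
    using E j I by (intro nn_integral_lborel_prod_slice[symmetric]) auto
  also have "\<dots> = emeasure ?P E" using E by simp
  finally show ?thesis .
qed

text \<open>
  The level \<open>1 - (1 - b)\<^sup>k\<close> is chosen so that one operator can be removed at a time:
  \<open>b + (1 - b) (1 - (1 - b)\<^sup>k) = 1 - (1 - b)\<^sup>k\<^sup>+\<^sup>1\<close>. The innermost operator is traded for replacing
  \<open>E\<close> by its superlevel set at level \<open>b\<close>, which costs one factor of the one-dimensional constant.
\<close>
lemma emeasure_superlevel_foldr_dir_maximal:
  assumes I: "finite I" and "set js \<subseteq> I" and "E \<in> sets (lborel_prod I)" and b: "0 < b" "b < 1"
  shows "emeasure (lborel_prod I)
           {x \<in> space (lborel_prod I).
              ennreal (1 - (1 - b) ^ length js) < foldr dir_maximal js (indicator E) x}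
           \<le> ennreal ((1 + 2 * ((1 - b) / b)) ^ length js) * emeasure (lborel_prod I) E"
  using assms(2,3)
proof (induction js arbitrary: E rule: rev_induct)
  case Nil
  then have "{x \<in> space (lborel_prod I). ennreal (1 - (1 - b) ^ length []) < foldr dir_maximal [] (indicator E) x} = E"
    using sets.sets_into_space by (auto simp: indicator_def)
  then show ?case by simp
next
  case (snoc j js)
  let ?P = "lborel_prod I" and ?C = "1 + 2 * ((1 - b) / b)" and ?k = "length js"
  let ?M = "dir_maximal j (indicator E)"
  define E' where "E' = {x \<in> space ?P. ennreal b < ?M x}"
  have C: "0 \<le> ?C" using b by auto
  have j: "j \<in> I" and js: "set js \<subseteq> I" using snoc.prems by auto
  have [measurable]: "?M \<in> borel_measurable ?P"
    using snoc.prems by (intro borel_measurable_dir_maximal) auto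
  have E': "E' \<in> sets ?P" unfolding E'_def by measurable
  have "{x \<in> space ?P. ennreal (1 - (1 - b) ^ length (js @ [j])) < foldr dir_maximal (js @ [j]) (indicator E) x}
      \<subseteq> {x \<in> space ?P. ennreal (1 - (1 - b) ^ ?k) < foldr dir_maximal js (indicator E') x}"
  proof safe
    fix x assume x: "x \<in> space ?P"
      and less: "ennreal (1 - (1 - b) ^ length (js @ [j])) < foldr dir_maximal (js @ [j]) (indicator E) x"
    have "?M y \<le> ennreal b + ennreal (1 - b) * indicator E' y" if "y \<in> space ?P" for y
    proof (cases "y \<in> E'")
      case True
      have "?M y \<le> 1" by (rule dir_maximal_le_const) (simp add: indicator_def)
      also have "1 = ennreal b + ennreal (1 - b)"
        using b by (simp flip: ennreal_plus)
      finally show ?thesis using True by simp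
    qed (use that in \<open>auto simp: E'_def not_less\<close>)
    then have "foldr dir_maximal js ?M x
        \<le> foldr dir_maximal js (\<lambda>y. ennreal b + ennreal (1 - b) * indicator E' y) x"
      using js x by (intro foldr_dir_maximal_mono)
    also have "\<dots> \<le> ennreal b + ennreal (1 - b) * foldr dir_maximal js (indicator E') x"
      using js x E' by (intro foldr_dir_maximal_affine_le[where I = I]) auto
    finally have le: "foldr dir_maximal js ?M x \<le> \<dots>" .
    show "ennreal (1 - (1 - b) ^ ?k) < foldr dir_maximal js (indicator E') x"
    proof (rule ccontr)
      assume "\<not> ?thesis"
      then have "ennreal b + ennreal (1 - b) * foldr dir_maximal js (indicator E') x
          \<le> ennreal b + ennreal (1 - b) * ennreal (1 - (1 - b) ^ ?k)"
        by (intro add_left_mono mult_left_mono) (auto simp: not_less)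
      also have "\<dots> = ennreal (1 - (1 - b) ^ length (js @ [j]))"
      proof -
        have "(1 - b) ^ ?k \<le> 1" using b by (intro power_le_one) auto
        then show ?thesis
          using b by (simp flip: ennreal_mult ennreal_plus) (simp add: algebra_simps)
      qed
      finally show False using le less by simp
    qed
  qed
  then have "emeasure ?P {x \<in> space ?P.
        ennreal (1 - (1 - b) ^ length (js @ [j])) < foldr dir_maximal (js @ [j]) (indicator E) x}
      \<le> emeasure ?P {x \<in> space ?P. ennreal (1 - (1 - b) ^ ?k) < foldr dir_maximal js (indicator E') x}"
  proof (rule emeasure_mono)
    have [measurable]: "foldr dir_maximal js (indicator E') \<in> borel_measurable ?P"
      using E' js by (intro borel_measurable_foldr_dir_maximal) auto
    show "{x \<in> space ?P. ennreal (1 - (1 - b) ^ ?k) < foldr dir_maximal js (indicator E') x} \<in> sets ?P"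
      by measurable
  qed
  also have "\<dots> \<le> ennreal (?C ^ ?k) * emeasure ?P E'"
    by (rule snoc.IH[OF js E'])
  also have "\<dots> \<le> ennreal (?C ^ ?k) * (ennreal ?C * emeasure ?P E)"
    unfolding E'_def using snoc.prems
    by (intro mult_left_mono emeasure_superlevel_dir_maximal[OF I j _ b]) auto
  also have "\<dots> = ennreal (?C ^ length (js @ [j])) * emeasure ?P E"
    using C by (simp add: ennreal_mult ac_simps)
  finally show ?case .
qed

section \<open>Lebesgue measurable sets\<close>

lemma sets_completion_sandwich:
  assumes "E \<in> sets (completion M)"
  obtains A B where "A \<in> sets M" "B \<in> sets M" "A \<subseteq> E" "E \<subseteq> B" "AE x in M. x \<in> A \<longleftrightarrow> x \<in> B"
    "emeasure M B = emeasure (completion M) E"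
proof -
  obtain S N N' where E: "E = S \<union> N" "N \<subseteq> N'" "N' \<in> null_sets M" "S \<in> sets M"
    using assms by (rule sets_completionE)
  have "emeasure M (S \<union> N') = emeasure M S"
    using E by (intro emeasure_Un_null_set)
  moreover have "emeasure M S \<le> emeasure (completion M) E"
  proof -
    have "emeasure M S = emeasure (completion M) S" using E by simp
    also have "\<dots> \<le> emeasure (completion M) E" using E assms by (intro emeasure_mono) auto
    finally show ?thesis .
  qed
  moreover have "emeasure (completion M) E \<le> emeasure (completion M) (S \<union> N')"
    using E by (intro emeasure_mono) auto
  moreover have "AE x in M. x \<in> S \<longleftrightarrow> x \<in> S \<union> N'"
    using AE_not_in[OF E(3)] by eventually_elim auto
  ultimately show thesis
    using E by (intro that[of S "S \<union> N'"]) (auto simp: null_setsD2)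
qed

text \<open>
  Reduces both measurability and the measure estimate to Borel sets: the superlevel set of \<open>E\<close> is
  squeezed between those of an inner and an outer Borel approximation of \<open>E\<close>, which differ by a null
  set.
\<close>
lemma superlevel_sandwich:
  assumes "E \<in> sets (lebesgue_n n)"
  obtains B where "B \<in> sets (lborel_prod {1..n})" "emeasure (lborel_prod {1..n}) B = emeasure (lebesgue_n n) E"
    "superlevel n \<alpha> E \<in> sets (lebesgue_n n)"
    "emeasure (lebesgue_n n) (superlevel n \<alpha> E) \<le> emeasure (lborel_prod {1..n}) (superlevel n \<alpha> B)"
proof -
  let ?P = "lborel_prod {1..n}" and ?js = "[1..<Suc n]"
  obtain A B where [measurable]: "A \<in> sets ?P" "B \<in> sets ?P" and "A \<subseteq> E" "E \<subseteq> B"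
    and ae: "AE x in ?P. x \<in> A \<longleftrightarrow> x \<in> B" and B: "emeasure ?P B = emeasure (lebesgue_n n) E"
    unfolding lebesgue_n_def
    by (rule sets_completion_sandwich[OF assms[unfolded lebesgue_n_def]])
  have js: "set ?js \<subseteq> {1..n}" by auto
  have sp: "space (lebesgue_n n) = space ?P" by (simp add: lebesgue_n_def)
  have sub: "superlevel n \<alpha> X \<subseteq> superlevel n \<alpha> Y" if "X \<subseteq> Y" for X Y
  proof -
    have "iter_maximal n (indicator X) x \<le> iter_maximal n (indicator Y) x" if "x \<in> space ?P" for x
      unfolding iter_maximal_def using \<open>X \<subseteq> Y\<close> js that
      by (intro foldr_dir_maximal_mono[where I = "{1..n}"]) (auto simp: indicator_def)
    then show ?thesis
      by (auto simp: superlevel_def sp intro: less_le_trans)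
  qed
  have meas: "superlevel n \<alpha> X \<in> sets ?P" if "X \<in> sets ?P" for X
  proof -
    have [measurable]: "iter_maximal n (indicator X) \<in> borel_measurable ?P"
      unfolding iter_maximal_def using that js by (intro borel_measurable_foldr_dir_maximal) auto
    show ?thesis unfolding superlevel_def sp by measurable
  qed
  let ?A = "superlevel n \<alpha> A" and ?B = "superlevel n \<alpha> B"
  have "AE x in ?P. iter_maximal n (indicator A) x = iter_maximal n (indicator B) x"
    unfolding iter_maximal_def
  proof (rule foldr_dir_maximal_cong_AE[OF _ js])
    show "AE x in ?P. indicator A x = (indicator B x :: ennreal)"
      using ae by eventually_elim (auto simp: indicator_def)
  qed (simp, (rule borel_measurable_indicator, fact)+)
  then have "AE x in ?P. x \<notin> ?B - ?A"
    by eventually_elim (auto simp: superlevel_def)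
  then have null: "?B - ?A \<in> null_sets ?P"
    by (rule AE_iff_null_sets[THEN iffD2, rotated]) (intro sets.Diff meas; fact)
  have in_compl: "superlevel n \<alpha> E \<in> sets (lebesgue_n n)"
    unfolding lebesgue_n_def
    by (rule sets_completionI[of _ ?A "superlevel n \<alpha> E - ?A" "?B - ?A"])
      (use sub[OF \<open>A \<subseteq> E\<close>] sub[OF \<open>E \<subseteq> B\<close>] null meas[OF \<open>A \<in> sets ?P\<close>] in auto)
  have "emeasure (lebesgue_n n) (superlevel n \<alpha> E) \<le> emeasure (lebesgue_n n) ?B"
    by (rule emeasure_mono) (use sub[OF \<open>E \<subseteq> B\<close>] meas[OF \<open>B \<in> sets ?P\<close>] in \<open>auto simp: lebesgue_n_def\<close>)
  also have "\<dots> = emeasure ?P ?B"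
    using meas[OF \<open>B \<in> sets ?P\<close>] by (simp add: lebesgue_n_def)
  finally show thesis
    by (intro that[of B]) (use B in_compl \<open>B \<in> sets ?P\<close> in auto)
qed

lemma tauberian_bound_superlevel:
  assumes n: "n \<ge> 1" and \<alpha>: "0 < \<alpha>" "\<alpha> < 1" and E: "E \<in> sets (lebesgue_n n)"
  defines "y \<equiv> (1 - \<alpha>) powr (1 / real n)"
  shows "emeasure (lebesgue_n n) (superlevel n \<alpha> E)
           \<le> ennreal ((1 + 4 * (y / (1 - y))) ^ n) * emeasure (lebesgue_n n) E"
proof -
  let ?P = "lborel_prod {1..n}" and ?js = "[1..<Suc n]"
  obtain B where B: "B \<in> sets ?P" "emeasure ?P B = emeasure (lebesgue_n n) E"
    and le: "emeasure (lebesgue_n n) (superlevel n \<alpha> E) \<le> emeasure ?P (superlevel n \<alpha> B)"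
    by (rule superlevel_sandwich[OF E])
  have yn: "y ^ n = 1 - \<alpha>"
    using \<alpha> n by (simp add: y_def powr_realpow[symmetric] powr_powr)
  have y: "0 < y" "y < 1"
    using \<alpha> yn one_le_power[of y n] by (auto simp: y_def not_le[symmetric])
  have "emeasure ?P (superlevel n \<alpha> B) =
      emeasure ?P {x \<in> space ?P. ennreal (1 - (1 - (1 - y)) ^ length ?js) < foldr dir_maximal ?js (indicator B) x}"
    using yn by (simp add: superlevel_def lebesgue_n_def iter_maximal_def del: upt_Suc)
  also have "\<dots> \<le> ennreal ((1 + 2 * ((1 - (1 - y)) / (1 - y))) ^ length ?js) * emeasure ?P B"
    using y by (intro emeasure_superlevel_foldr_dir_maximal B) auto
  also have "\<dots> \<le> ennreal ((1 + 4 * (y / (1 - y))) ^ n) * emeasure ?P B"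
    using y by (intro mult_right_mono ennreal_leI) (auto intro!: power_mono divide_right_mono simp del: upt_Suc)
  finally show ?thesis using le B by simp
qed

section \<open>A cube with diagonal slots\<close>

text \<open>
  As \<open>u\<close> runs through the unit interval, \<open>a + u\<close> passes an integer at \<open>u = 1 - frac a\<close>. This cuts
  the set into two open intervals of total length \<open>1 - e\<close>, whatever \<open>a\<close> is. Openness is what keeps
  the maximal functions equal to \<open>1\<close> on the slotted cube.
\<close>
lemma frac_gt_section:
  fixes a e :: real
  assumes "0 \<le> e"
  shows "{u. 0 < u \<and> u < 1 \<and> e < frac (a + u)} =
           {max 0 (e - frac a)<..<1 - frac a} \<union> {1 - frac a + e<..<1}"
proof -
  define r where "r = frac a"
  have r: "0 \<le> r" "r < 1" by (auto simp: r_def frac_lt_1)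
  have "e < frac (a + u) \<longleftrightarrow> e - r < u \<and> u < 1 - r \<or> 1 - r + e < u"
    if u: "0 < u" "u < 1" for u
  proof -
    have "frac u = u" using u by (simp add: frac_eq)
    then show ?thesis
      using frac_add[of a u] assms r u by (auto simp flip: r_def)
  qed
  then show ?thesis
    unfolding r_def[symmetric] using r assms by auto
qed

lemma emeasure_frac_gt_section:
  fixes a e :: real
  assumes "0 \<le> e" "e \<le> 1"
  shows "emeasure lborel {u. 0 < u \<and> u < 1 \<and> e < frac (a + u)} = ennreal (1 - e)"
proof -
  have a: "0 \<le> frac a" "frac a < 1" by (auto simp: frac_lt_1)
  have "emeasure lborel {u. 0 < u \<and> u < 1 \<and> e < frac (a + u)}
      = emeasure lborel {max 0 (e - frac a)<..<1 - frac a} + emeasure lborel {1 - frac a + e<..<1}"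
    unfolding frac_gt_section[OF assms(1)] using assms(1) by (intro plus_emeasure[symmetric]) auto
  also have "\<dots> = ennreal (1 - e)"
  proof (cases "e \<le> frac a")
    case True
    then show ?thesis
      using a assms by (simp add: max_def flip: ennreal_plus)
  next
    case False
    then show ?thesis
      using a assms by (simp add: max_def)
  qed
  finally show ?thesis .
qed

definition unit_cube :: "nat set \<Rightarrow> (nat \<Rightarrow> real) set" where
  "unit_cube I = {x \<in> space (lborel_prod I). \<forall>i\<in>I. 0 < x i \<and> x i < 1}"

text \<open>
  The fractional part of the sum makes the slots periodic, so that every axis-parallel segment across
  the cube meets them in the same length. They are closed relative to the cube, which makes the
  sections of the slotted cube open.
\<close>
definition slotted_cube :: "nat set \<Rightarrow> real \<Rightarrow> (nat \<Rightarrow> real) set" where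
  "slotted_cube I e = {x \<in> unit_cube I. e < frac (\<Sum>i\<in>I. x i)}"

lemma unit_cube_eq_PiE: "unit_cube I = PiE I (\<lambda>_. {0<..<1})"
  by (auto simp: unit_cube_def space_PiM PiE_iff extensional_def)

lemma sets_unit_cube: "finite I \<Longrightarrow> unit_cube I \<in> sets (lborel_prod I)"
  unfolding unit_cube_eq_PiE by (intro sets_PiM_I_finite) auto

lemma emeasure_unit_cube: "finite I \<Longrightarrow> emeasure (lborel_prod I) (unit_cube I) = 1"
  unfolding unit_cube_eq_PiE by (subst lborel_prod.emeasure_PiM) auto

lemma sets_slotted_cube:
  assumes "finite I"
  shows "slotted_cube I e \<in> sets (lborel_prod I)"
proof -
  have "(\<lambda>x. \<Sum>i\<in>I. x i) \<in> borel_measurable (lborel_prod I)"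
    by (intro borel_measurable_sum) (use measurable_component_singleton[of _ I "\<lambda>_. lborel"] in simp)
  then have "{x \<in> space (lborel_prod I). e < frac (\<Sum>i\<in>I. x i)} \<in> sets (lborel_prod I)"
    unfolding frac_def by measurable
  moreover have "slotted_cube I e = unit_cube I \<inter> {x \<in> space (lborel_prod I). e < frac (\<Sum>i\<in>I. x i)}"
    by (auto simp: slotted_cube_def unit_cube_def)
  ultimately show ?thesis
    using sets_unit_cube[OF assms] by auto
qed

lemma slotted_cube_section:
  assumes "finite I" "j \<in> I" "x \<in> space (lborel_prod I) \<or> x \<in> space (lborel_prod (I - {j}))"
    and cube: "\<And>i. i \<in> I - {j} \<Longrightarrow> 0 < x i \<and> x i < 1"
  shows "x(j := u) \<in> slotted_cube I e \<longleftrightarrow> 0 < u \<and> u < 1 \<and> e < frac ((\<Sum>i\<in>I - {j}. x i) + u)"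
proof -
  have "(\<Sum>i\<in>I. (x(j := u)) i) = u + (\<Sum>i\<in>I - {j}. (x(j := u)) i)"
    using assms by (subst sum.remove[of I j]) auto
  also have "(\<Sum>i\<in>I - {j}. (x(j := u)) i) = (\<Sum>i\<in>I - {j}. x i)"
    by (intro sum.cong) auto
  finally show ?thesis
    using cube fun_upd_in_space[of x I j u] assms
    by (auto simp: slotted_cube_def unit_cube_def add.commute)
qed

text \<open>
  Integrate the section length \<open>1 - e\<close> over the unit cube in the other coordinates.
\<close>
lemma emeasure_slotted_cube:
  assumes I: "finite I" and j: "j \<in> I" and e: "0 \<le> e" "e \<le> 1"
  shows "emeasure (lborel_prod I) (slotted_cube I e) = ennreal (1 - e)"
proof -
  let ?J = "I - {j}"
  have "emeasure (lborel_prod I) (slotted_cube I e)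
      = (\<integral>\<^sup>+x. emeasure lborel {u. x(j := u) \<in> slotted_cube I e} \<partial>lborel_prod ?J)"
    using I j by (intro emeasure_lborel_prod_slice sets_slotted_cube)
  also have "\<dots> = (\<integral>\<^sup>+x. ennreal (1 - e) * indicator (unit_cube ?J) x \<partial>lborel_prod ?J)"
  proof (rule nn_integral_cong)
    fix x assume x: "x \<in> space (lborel_prod ?J)"
    show "emeasure lborel {u. x(j := u) \<in> slotted_cube I e} = ennreal (1 - e) * indicator (unit_cube ?J) x"
    proof (cases "x \<in> unit_cube ?J")
      case True
      then have "0 < x i \<and> x i < 1" if "i \<in> ?J" for i
        using that by (auto simp: unit_cube_def)
      then have "{u. x(j := u) \<in> slotted_cube I e} = {u. 0 < u \<and> u < 1 \<and> e < frac ((\<Sum>i\<in>?J. x i) + u)}"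
        using slotted_cube_section[OF I j, of x] x by auto
      then show ?thesis
        using True emeasure_frac_gt_section[OF e, of "\<Sum>i\<in>?J. x i"] by simp
    next
      case False
      then obtain i where "i \<in> I" "i \<noteq> j" "\<not> (0 < x i \<and> x i < 1)"
        using x by (auto simp: unit_cube_def)
      then have "x(j := u) \<notin> slotted_cube I e" for u
        by (auto simp: slotted_cube_def unit_cube_def)
      then show ?thesis using False by simp
    qed
  qed
  also have "\<dots> = ennreal (1 - e)"
    using I by (simp add: nn_integral_cmult_indicator sets_unit_cube emeasure_unit_cube)
  finally show ?thesis .
qed

text \<open>
  For a point of the slotted cube, short intervals around it on the line stay in the slotted cube
  and give the average \<open>1\<close>. For any point of the cube, average over the whole segment: a portion
  \<open>1 - e\<close> carries the value \<open>1\<close> and the rest at least \<open>1 - e\<^sup>k\<close>, which makes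
  \<open>(1 - e) + e (1 - e\<^sup>k) = 1 - e\<^sup>k\<^sup>+\<^sup>1\<close>.
\<close>
lemma foldr_dir_maximal_slotted_cube_ge:
  assumes I: "finite I" and "set js \<subseteq> I" and e: "0 \<le> e" "e \<le> 1" and "x \<in> unit_cube I"
  shows "ennreal (1 - e ^ length js) \<le> foldr dir_maximal js (indicator (slotted_cube I e)) x \<and>
    (x \<in> slotted_cube I e \<longrightarrow> 1 \<le> foldr dir_maximal js (indicator (slotted_cube I e)) x)"
  using assms(2,5)
proof (induction js arbitrary: x)
  case (Cons j js)
  define f where "f = foldr dir_maximal js (indicator (slotted_cube I e))"
  define T where "T = {u. x(j := u) \<in> slotted_cube I e}"
  define a where "a = (\<Sum>i\<in>I - {j}. x i)"
  let ?k = "length js"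
  have j: "j \<in> I" and js: "set js \<subseteq> I" using Cons.prems by auto
  have x: "x \<in> space (lborel_prod I)" and x01: "\<And>i. i \<in> I \<Longrightarrow> 0 < x i \<and> x i < 1"
    using Cons.prems by (auto simp: unit_cube_def)
  have T: "T = {u. 0 < u \<and> u < 1 \<and> e < frac (a + u)}"
    using slotted_cube_section[OF I j, of x] x x01 by (auto simp: T_def a_def)
  have T_sets [measurable]: "T \<in> sets lborel" and "open T"
    unfolding T frac_gt_section[OF e(1)] by auto
  have T_measure: "emeasure lborel T = ennreal (1 - e)"
    unfolding T by (rule emeasure_frac_gt_section[OF e])
  have on_T: "1 \<le> f (x(j := u))" if "u \<in> T" for u
  proof -
    have "x(j := u) \<in> slotted_cube I e" using that by (simp add: T_def)
    moreover from this have "x(j := u) \<in> unit_cube I" by (simp add: slotted_cube_def)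
    ultimately show ?thesis using Cons.IH[OF js] unfolding f_def by blast
  qed
  have on_line: "ennreal (1 - e ^ ?k) \<le> f (x(j := u))" if "u \<in> {0<..<1}" for u
  proof -
    have "x(j := u) \<in> unit_cube I"
      using that x x01 fun_upd_in_space[of x I j u] j by (simp add: unit_cube_def)
    then show ?thesis using Cons.IH[OF js] unfolding f_def by blast
  qed
  have ek: "e ^ ?k \<le> 1" "0 \<le> e ^ ?k" using e by (auto intro: power_le_one)
  have "ennreal (1 - e ^ Suc ?k) \<le> dir_maximal j f x"
  proof (rule le_dir_maximal[where s = 0 and t = 1])
    have "ennreal (1 - e ^ Suc ?k) = ennreal (1 - e ^ ?k) + ennreal (e ^ ?k) * ennreal (1 - e)"
      using e ek by (simp flip: ennreal_plus ennreal_mult) (simp add: algebra_simps)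
    \<comment> \<open>The integrand below is \<open>1 - e ^ ?k\<close> across the cube and \<open>1\<close> on the section \<open>T\<close>.\<close>
    also have "\<dots> = (\<integral>\<^sup>+u. ennreal (1 - e ^ ?k) * indicator {0<..<1} u + ennreal (e ^ ?k) * indicator T u \<partial>lborel)"
      using T_sets by (simp add: nn_integral_add nn_integral_cmult_indicator T_measure)
    also have "\<dots> \<le> (\<integral>\<^sup>+u\<in>{0..1}. f (x(j := u)) \<partial>lborel)"
    proof (rule nn_integral_mono)
      fix u :: real
      have "ennreal (1 - e ^ ?k) + ennreal (e ^ ?k) = 1"
        using ek by (simp flip: ennreal_plus)
      then show "ennreal (1 - e ^ ?k) * indicator {0<..<1} u + ennreal (e ^ ?k) * indicator T u
          \<le> f (x(j := u)) * indicator {0..1} u"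
        using on_T[of u] on_line[of u] by (auto simp: indicator_def T)
    qed
    finally show "ennreal (1 - e ^ Suc ?k) * ennreal (1 - 0) \<le> (\<integral>\<^sup>+u\<in>{0..1}. f (x(j := u)) \<partial>lborel)"
      by simp
  qed (use x01 j in auto)
  moreover have "1 \<le> dir_maximal j f x" if "x \<in> slotted_cube I e"
  proof -
    have "x j \<in> T" using that by (simp add: T_def)
    then obtain d where d: "0 < d" "cball (x j) d \<subseteq> T"
      using \<open>open T\<close> open_contains_cball by blast
    then have sub: "{x j - d..x j + d} \<subseteq> T" by (simp add: cball_eq_atLeastAtMost)
    show ?thesis
    proof (rule le_dir_maximal[where s = "x j - d" and t = "x j + d"])
      have "1 * ennreal (x j + d - (x j - d)) = (\<integral>\<^sup>+u. indicator {x j - d..x j + d} u \<partial>lborel)"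
        using d by simp
      also have "\<dots> \<le> (\<integral>\<^sup>+u\<in>{x j - d..x j + d}. f (x(j := u)) \<partial>lborel)"
        using sub on_T by (intro nn_integral_mono) (auto simp: indicator_def)
      finally show "1 * ennreal (x j + d - (x j - d)) \<le> (\<integral>\<^sup>+u\<in>{x j - d..x j + d}. f (x(j := u)) \<partial>lborel)" .
    qed (use d in auto)
  qed
  ultimately show ?case by (simp add: f_def)
qed (auto simp: indicator_def)

text \<open>
  The slotted cube has measure \<open>1 - e\<close> and its superlevel set contains the unit cube, so the ratio is
  at least \<open>1 / (1 - e) \<ge> 1 + e\<close>.
\<close>
lemma tauberian_const_ge:
  assumes n: "n \<ge> 1" and e: "0 < e" "e < 1" and \<alpha>: "\<alpha> < 1 - e ^ n"
  shows "ennreal (1 + e) \<le> tauberian_const n \<alpha>"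
proof -
  let ?P = "lborel_prod {1..n}" and ?Q = "unit_cube {1..n}" and ?E = "slotted_cube {1..n} e"
  have E: "?E \<in> sets ?P" by (intro sets_slotted_cube) auto
  have E_measure: "emeasure (lebesgue_n n) ?E = ennreal (1 - e)"
    unfolding lebesgue_n_def
    using E emeasure_slotted_cube[of "{1..n}" 1 e] n e by simp
  have en: "e ^ n \<le> 1" using e by (intro power_le_one) auto
  have "?Q \<subseteq> superlevel n \<alpha> ?E"
  proof
    fix x assume x: "x \<in> ?Q"
    have "ennreal \<alpha> < ennreal (1 - e ^ n)"
      using \<alpha> e n by (intro ennreal_lessI) (auto simp: power_less_one_iff)
    also have "\<dots> \<le> iter_maximal n (indicator ?E) x"
    proof -
      have "ennreal (1 - e ^ length [1..<Suc n]) \<le> foldr dir_maximal [1..<Suc n] (indicator ?E) x"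
        by (rule foldr_dir_maximal_slotted_cube_ge[THEN conjunct1]) (use x e in auto)
      then show ?thesis by (simp add: iter_maximal_def del: upt_Suc)
    qed
    finally show "x \<in> superlevel n \<alpha> ?E"
      using x by (simp add: superlevel_def lebesgue_n_def unit_cube_def)
  qed
  moreover have "superlevel n \<alpha> ?E \<in> sets (lebesgue_n n)"
    by (rule superlevel_sandwich[of ?E n \<alpha>]) (use E in \<open>auto simp: lebesgue_n_def\<close>)
  ultimately have "emeasure (lebesgue_n n) ?Q \<le> emeasure (lebesgue_n n) (superlevel n \<alpha> ?E)"
    by (rule emeasure_mono)
  then have ge1: "1 \<le> emeasure (lebesgue_n n) (superlevel n \<alpha> ?E)"
    using sets_unit_cube[of "{1..n}"] emeasure_unit_cube[of "{1..n}"] by (simp add: lebesgue_n_def)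
  have "(1 + e) * (1 - e) \<le> 1" by (simp add: algebra_simps)
  then have "1 + e \<le> 1 / (1 - e)" using e by (simp add: field_simps)
  then have "ennreal (1 + e) \<le> ennreal (1 / (1 - e))"
    by (rule ennreal_leI)
  also have "\<dots> = 1 / ennreal (1 - e)"
    using e divide_ennreal[of 1 "1 - e"] by simp
  also have "\<dots> \<le> emeasure (lebesgue_n n) (superlevel n \<alpha> ?E) / emeasure (lebesgue_n n) ?E"
    unfolding E_measure by (intro divide_right_mono_ennreal ge1)
  also have "\<dots> \<le> tauberian_const n \<alpha>"
    unfolding tauberian_const_def
    by (rule SUP_upper) (use E E_measure e in \<open>auto simp: lebesgue_n_def\<close>)
  finally show ?thesis .
qed

section \<open>Growth of the Tauberian constant near level one\<close>

lemma tauberian_const_le: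
  assumes "n \<ge> 1" "0 < \<alpha>" "\<alpha> < 1"
  defines "y \<equiv> (1 - \<alpha>) powr (1 / real n)"
  shows "tauberian_const n \<alpha> \<le> ennreal ((1 + 4 * (y / (1 - y))) ^ n)"
  unfolding tauberian_const_def
proof (rule SUP_least)
  fix E assume "E \<in> {E \<in> sets (lebesgue_n n). 0 < emeasure (lebesgue_n n) E \<and> emeasure (lebesgue_n n) E < \<infinity>}"
  then show "emeasure (lebesgue_n n) (superlevel n \<alpha> E) / emeasure (lebesgue_n n) E
      \<le> ennreal ((1 + 4 * (y / (1 - y))) ^ n)"
    using tauberian_bound_superlevel[of n \<alpha> E] assms
    by (intro divide_le_posI_ennreal) (auto simp: mult.commute)
qed

lemma power_one_plus_le_linear:
  fixes y K :: real
  assumes "0 \<le> y" "y \<le> 1" "0 \<le> K"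
  shows "(1 + K * y) ^ n \<le> 1 + (1 + K) ^ n * y"
proof (induction n)
  case (Suc n)
  have "(1 + K * y) ^ Suc n = (1 + K * y) ^ n + K * y * (1 + K * y) ^ n"
    by (simp add: algebra_simps)
  also have "\<dots> \<le> (1 + (1 + K) ^ n * y) + K * y * (1 + K) ^ n"
    using assms Suc.IH by (intro add_mono mult_left_mono power_mono) (auto intro: mult_left_le)
  also have "\<dots> = 1 + (1 + K) ^ Suc n * y"
    by (simp add: algebra_simps)
  finally show ?case .
qed (use assms in simp)

theorem theorem2:
  fixes n :: nat
  assumes "n \<ge> 1"
  shows "(\<forall>\<alpha>::real. 0 < \<alpha> \<and> \<alpha> < 1 \<longrightarrow> (\<forall>E \<in> sets (lebesgue_n n).
            superlevel n \<alpha> E \<in> sets (lebesgue_n n) \<and>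
            emeasure (lebesgue_n n) (superlevel n \<alpha> E)
              \<le> ennreal ((1 + 4 * ((1 - \<alpha>) powr (1 / real n) / (1 - (1 - \<alpha>) powr (1 / real n)))) ^ n)
                 * emeasure (lebesgue_n n) E))
       \<and> (\<exists>c c' \<alpha>\<^sub>0::real. 0 < c \<and> 0 < c' \<and> 0 < \<alpha>\<^sub>0 \<and> \<alpha>\<^sub>0 < 1 \<and>
            (\<forall>\<alpha>. \<alpha>\<^sub>0 < \<alpha> \<and> \<alpha> < 1 \<longrightarrow>
               ennreal (c * (1 / \<alpha> - 1) powr (1 / real n)) \<le> tauberian_const n \<alpha> - 1 \<and>
               tauberian_const n \<alpha> - 1 \<le> ennreal (c' * (1 / \<alpha> - 1) powr (1 / real n))))"
proof (intro conjI)
  have "superlevel n \<alpha> E \<in> sets (lebesgue_n n)" if "E \<in> sets (lebesgue_n n)" for \<alpha> E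
    by (rule superlevel_sandwich[OF that])
  then show "\<forall>\<alpha>::real. 0 < \<alpha> \<and> \<alpha> < 1 \<longrightarrow> (\<forall>E \<in> sets (lebesgue_n n).
            superlevel n \<alpha> E \<in> sets (lebesgue_n n) \<and>
            emeasure (lebesgue_n n) (superlevel n \<alpha> E)
              \<le> ennreal ((1 + 4 * ((1 - \<alpha>) powr (1 / real n) / (1 - (1 - \<alpha>) powr (1 / real n)))) ^ n)
                 * emeasure (lebesgue_n n) E)"
    using tauberian_bound_superlevel[OF assms] by blast
next
  \<comment> \<open>Above this level \<open>(1 - \<alpha>) powr (1 / real n) < 1 / 2\<close>, which keeps the denominator away from \<open>0\<close>.\<close>
  define \<alpha>\<^sub>0 :: real where "\<alpha>\<^sub>0 = 1 - (1 / 2) ^ n"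
  have "(1 / 2 :: real) ^ n \<le> (1 / 2) ^ 1"
    using assms by (intro power_decreasing) auto
  then have \<alpha>0: "1 / 2 \<le> \<alpha>\<^sub>0" "\<alpha>\<^sub>0 < 1" by (auto simp: \<alpha>\<^sub>0_def)
  have lower: "ennreal (1 / 4 * (1 / \<alpha> - 1) powr (1 / real n)) \<le> tauberian_const n \<alpha> - 1"
    and upper: "tauberian_const n \<alpha> - 1 \<le> ennreal (9 ^ n * (1 / \<alpha> - 1) powr (1 / real n))"
    if \<alpha>: "\<alpha>\<^sub>0 < \<alpha>" "\<alpha> < 1" for \<alpha>
  proof -
    have \<alpha>': "1 / 2 < \<alpha>" using \<alpha> \<alpha>0 by simp
    have root: "(r powr (1 / real n)) ^ n = r" if "0 < r" for r
      using that assms by (simp add: powr_realpow[symmetric] powr_powr)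
    define w where "w = (1 / \<alpha> - 1) powr (1 / real n)"
    show "ennreal (1 / 4 * w) \<le> tauberian_const n \<alpha> - 1"
    proof -
      \<comment> \<open>The factor \<open>1 / 2\<close> gives the strict inequality \<open>\<alpha> < 1 - e ^ n\<close>.\<close>
      define e where "e = ((1 - \<alpha>) / 2) powr (1 / real n)"
      have en: "e ^ n = (1 - \<alpha>) / 2" using root \<alpha> by (simp add: e_def)
      have "0 < e" using \<alpha> by (simp add: e_def)
      moreover have "e < 1"
        using one_le_power[of e n] en \<alpha> \<alpha>' by (auto simp: not_le[symmetric])
      moreover have "\<alpha> < 1 - e ^ n" using en \<alpha> by (simp add: field_simps)
      ultimately have ge: "ennreal (1 + e) \<le> tauberian_const n \<alpha>"
        using tauberian_const_ge assms by blast
      have "w ^ n = 1 / \<alpha> - 1"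
        unfolding w_def using \<alpha> \<alpha>' by (intro root) (simp add: field_simps)
      also have "\<dots> \<le> 4 * e ^ n"
      proof -
        have "(1 - \<alpha>) / \<alpha> \<le> (1 - \<alpha>) / (1 / 2)"
          using \<alpha> \<alpha>' by (intro divide_left_mono) auto
        then show ?thesis using en \<alpha>' by (simp add: diff_divide_distrib)
      qed
      also have "\<dots> \<le> 4 ^ n * e ^ n"
        using assms \<open>0 < e\<close> power_increasing[of 1 n "4::real"] by (intro mult_right_mono) auto
      finally have "w ^ n \<le> (4 * e) ^ n" by (simp add: power_mult_distrib)
      then have "w \<le> 4 * e"
        using \<open>0 < e\<close> assms by (subst (asm) power_mono_iff) (auto simp: w_def)
      then have "ennreal (1 / 4 * w) \<le> ennreal ((1 + e) - 1)"
        by (intro ennreal_leI) simp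
      also have "\<dots> = ennreal (1 + e) - 1"
        by (simp add: ennreal_minus flip: ennreal_1)
      also have "\<dots> \<le> tauberian_const n \<alpha> - 1"
        by (intro ennreal_minus_mono ge) simp
      finally show ?thesis .
    qed
    show "tauberian_const n \<alpha> - 1 \<le> ennreal (9 ^ n * w)"
    proof -
      define y where "y = (1 - \<alpha>) powr (1 / real n)"
      have yn: "y ^ n = 1 - \<alpha>" using root \<alpha> by (simp add: y_def)
      have "0 < y" using \<alpha> by (simp add: y_def)
      have "y ^ n < (1 / 2) ^ n" using yn \<alpha> by (simp add: \<alpha>\<^sub>0_def)
      then have "y < 1 / 2"
        by (rule power_less_imp_less_base) simp
      have "y / (1 - y) \<le> y / (1 / 2)"
        using \<open>0 < y\<close> \<open>y < 1 / 2\<close> by (intro divide_left_mono) auto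
      then have "(1 + 4 * (y / (1 - y))) ^ n \<le> (1 + 8 * y) ^ n"
        using \<open>0 < y\<close> \<open>y < 1 / 2\<close> by (intro power_mono) auto
      also have "\<dots> \<le> 1 + 9 ^ n * y"
        using power_one_plus_le_linear[of y 8 n] \<open>0 < y\<close> \<open>y < 1 / 2\<close> by simp
      finally have le: "(1 + 4 * (y / (1 - y))) ^ n \<le> 1 + 9 ^ n * y" .
      have "1 - \<alpha> \<le> 1 / \<alpha> - 1"
      proof -
        have "(1 - \<alpha>) / 1 \<le> (1 - \<alpha>) / \<alpha>"
          using \<alpha> \<alpha>' by (intro divide_left_mono) auto
        then show ?thesis using \<alpha>' by (simp add: diff_divide_distrib)
      qed
      then have "y \<le> w"
        unfolding y_def w_def using \<alpha> by (intro powr_mono2) auto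
      have "tauberian_const n \<alpha> \<le> ennreal ((1 + 4 * (y / (1 - y))) ^ n)"
        unfolding y_def using assms \<alpha> \<alpha>' by (intro tauberian_const_le) auto
      also have "\<dots> \<le> ennreal (1 + 9 ^ n * y)"
        by (intro ennreal_leI le)
      finally have "tauberian_const n \<alpha> - 1 \<le> ennreal (1 + 9 ^ n * y) - 1"
        by (intro ennreal_minus_mono) auto
      also have "\<dots> = ennreal (9 ^ n * y)"
        using \<open>0 < y\<close> by (simp add: ennreal_minus flip: ennreal_1)
      also have "\<dots> \<le> ennreal (9 ^ n * w)"
        using \<open>y \<le> w\<close> by (intro ennreal_leI) auto
      finally show ?thesis .
    qed
  qed
  show "\<exists>c c' \<alpha>\<^sub>0::real. 0 < c \<and> 0 < c' \<and> 0 < \<alpha>\<^sub>0 \<and> \<alpha>\<^sub>0 < 1 \<and>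
            (\<forall>\<alpha>. \<alpha>\<^sub>0 < \<alpha> \<and> \<alpha> < 1 \<longrightarrow>
               ennreal (c * (1 / \<alpha> - 1) powr (1 / real n)) \<le> tauberian_const n \<alpha> - 1 \<and>
               tauberian_const n \<alpha> - 1 \<le> ennreal (c' * (1 / \<alpha> - 1) powr (1 / real n)))"
    by (rule exI[of _ "1 / 4"], rule exI[of _ "9 ^ n"], rule exI[of _ \<alpha>\<^sub>0])
      (use \<alpha>0 lower upper in auto)
qed

end
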